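(* Let $d\ge 2$, $0<h<1$, and let a signal $F\in\bar{\mathcal{P}}_d$ form an $(h,\eta,\gamma)$-regular cluster. Then for each integer $l$ with $0\le l<d$ and each $\tilde F\in\mathcal{P}_l$, $$\|\bar m(F)-\bar m(\tilde F)\|\ \ge\ \theta_h:=\min\left(h^{2d-2},\ \frac{\eta^{d(d-1)}\,\gamma^d\,h^{2d-2}\,\prod_{i=1}^{d-1}(i!)^2}{\sqrt{2d-1}\;d^2\;d!\;(d+1)^{d-1}}\right).$$
   Context: For $n\ge 1$, $\mathcal{P}_n=\{(a,x)=(a_1,\ldots,a_n,x_1,\ldots,x_n)\in\mathbb{R}^{2n} : x_1<\cdots<x_n,\ a_i\neq 0,\ i=1,\ldots,n\}$; a tuple $(a,x)\in\mathcal{P}_n$ is identified with the signal $G(x)=\sum_{j=1}^n a_j\delta(x-x_j)$ with $n$ nodes. $\mathcal{P}_0$ is the singleton containing the zero signal. $\bar{\mathcal{P}}_d\subset\mathcal{P}_d$ is the set of signals for which $|x_j|\le 1$ and $|a_j|\le 1$ for all $j=1,\ldots,d$ (no such bounds are assumed for $\tilde F$). The moments of a signal $G=(a,x)\in\mathcal{P}_n$ are $m_k(G)=\sum_{j=1}^n a_jx_j^k$, $k\ge 0$ (with $x_j^0=1$); all moments of the zero signal are $0$. For any signal $G$, $\bar m(G)=(m_0(G),\ldots,m_{2d-2}(G))\in\mathbb{R}^{2d-1}$, and $\|\cdot\|$ is the Euclidean norm. For $0<\eta\le\frac{2}{d-1}$ and $0<\gamma\le 1$, a signal $G=(a,x)\in\bar{\mathcal{P}}_d$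 is called $(\eta,\gamma)$-regular if $x_{j+1}-x_j\ge\eta$ for $j=1,\ldots,d-1$ and $|a_j|\ge\gamma$ for $j=1,\ldots,d$. A signal $F$ forms an $(h,\eta,\gamma)$-regular cluster if its nodes are obtained by an $h$-downscaling of an $(\eta,\gamma)$-regular signal $G=(a,x)\in\bar{\mathcal{P}}_d$, i.e. $F=(a,hx)$: $F$ has the amplitudes $a_1,\ldots,a_d$ of $G$ and nodes $hx_1,\ldots,hx_d$. *)

theory Defs
  imports "HOL-Analysis.Analysis"
begin

text \<open>
  A signal with \<open>n\<close> nodes is the pair \<open>(a, x)\<close> of its amplitude list and its node list, both of
  length \<open>n\<close>. Entries are counted from \<open>0\<close>, so \<open>a ! j\<close> is the amplitude \<open>a\<^sub>j\<^sub>+\<^sub>1\<close> of the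
  literature; the zero signal is \<open>([], [])\<close>.
\<close>

type_synonym signal = "real list \<times> real list"

definition signals :: "nat \<Rightarrow> signal set" where
  "signals n = {(a, x). length a = n \<and> length x = n \<and>
                        sorted_wrt (<) x \<and> (\<forall>j<n. a ! j \<noteq> 0)}"

definition bounded_signals :: "nat \<Rightarrow> signal set" where
  "bounded_signals d = {(a, x). (a, x) \<in> signals d \<and>
                                (\<forall>j<d. \<bar>x ! j\<bar> \<le> 1 \<and> \<bar>a ! j\<bar> \<le> 1)}"

definition moment :: "nat \<Rightarrow> signal \<Rightarrow> real" where
  "moment k G = (case G of (a, x) \<Rightarrow> \<Sum>j<length a. a ! j * (x ! j) ^ k)"

text \<open>
  The Euclidean distance in \<open>\<real>\<^bsup>2d-1\<^esup>\<close> of the vectors of moments \<open>m\<^sub>0, \<dots>, m\<^bsub>2d-2\<^esub>\<close>.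
  The dimension varies with \<open>d\<close>, so the norm is \<open>L2_set\<close> over the index set \<open>{0..2d-2}\<close>.
\<close>

definition moment_dist :: "nat \<Rightarrow> signal \<Rightarrow> signal \<Rightarrow> real" where
  "moment_dist d F G = L2_set (\<lambda>k. moment k F - moment k G) {0..2 * d - 2}"

definition regular_signal :: "nat \<Rightarrow> real \<Rightarrow> real \<Rightarrow> signal \<Rightarrow> bool" where
  "regular_signal d \<eta> \<gamma> G \<longleftrightarrow> G \<in> bounded_signals d \<and>
     (case G of (a, x) \<Rightarrow>
        (\<forall>j. Suc j < d \<longrightarrow> x ! Suc j - x ! j \<ge> \<eta>) \<and> (\<forall>j<d. \<bar>a ! j\<bar> \<ge> \<gamma>))"

definition downscale :: "real \<Rightarrow> signal \<Rightarrow> signal" where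
  "downscale h G = (case G of (a, x) \<Rightarrow> (a, map (\<lambda>t. h * t) x))"

definition regular_cluster :: "nat \<Rightarrow> real \<Rightarrow> real \<Rightarrow> real \<Rightarrow> signal \<Rightarrow> bool" where
  "regular_cluster d h \<eta> \<gamma> F \<longleftrightarrow> (\<exists>G. regular_signal d \<eta> \<gamma> G \<and> F = downscale h G)"

end

theory Submission
  imports Defs "Jordan_Normal_Form.Determinant"
begin

text \<open>
  Undoing the scaling by \<open>h\<close> amplifies a moment difference by a factor of at most \<open>1 / h ^ (2d-2)\<close>, so it suffices
  to treat a regular signal \<open>G\<close>. The Hankel matrix of the moments \<open>m\<^sub>i\<^sub>+\<^sub>j\<close> of a signal with \<open>d\<close> nodes
  factors as \<open>V\<^sup>T diag(a) V\<close> with \<open>V\<close> the Vandermonde matrix of the nodes. Its determinant is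
  therefore bounded below for \<open>G\<close>, and it vanishes for a signal with fewer than \<open>d\<close> nodes, since such
  a signal can be padded with zero amplitudes. As the determinant is Lipschitz in the entries, the two
  moment sequences cannot be too close.
\<close>

text \<open>Passing from monomials to the Newton basis \<open>p j\<close> multiplies
  \<open>V\<close> by the coefficient matrix \<open>C\<close>, which is upper triangular with unit
  diagonal. The product has entries p_j(x_i); since \<open>p j\<close> vanishes at x_i for i < j, it
  is lower triangular, and its diagonal gives the formula.\<close>

lemma det_vandermonde:
  fixes x :: "nat \<Rightarrow> 'a::idom"
  shows "Determinant.det (Matrix.mat n n (\<lambda>(i, j). x i ^ j)) = (\<Prod>i<n. \<Prod>k<i. x i - x k)"
proof -
  define p where "p j = (\<Prod>k<j. [:- x k, 1:])" for j
  define V where "V = Matrix.mat n n (\<lambda>(i, j). x i ^ j)"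
  define C where "C = Matrix.mat n n (\<lambda>(i, j). coeff (p j) i)"
  have monic: "degree (p j) = j \<and> lead_coeff (p j) = 1" for j
  proof -
    have "lead_coeff (p j) = 1" by (simp add: p_def lead_coeff_prod)
    moreover have "degree (p j) = j"
      unfolding p_def by (subst degree_prod_eq_sum_degree) auto
    ultimately show ?thesis by simp
  qed
  have V: "V \<in> carrier_mat n n" and C: "C \<in> carrier_mat n n"
    by (simp_all add: V_def C_def)
  have entry: "(V * C) $$ (i, j) = (\<Prod>k<j. x i - x k)" if "i < n" "j < n" for i j
  proof -
    have "(V * C) $$ (i, j) = (\<Sum>m<n. x i ^ m * coeff (p j) m)"
      using that by (simp add: V_def C_def scalar_prod_def lessThan_atLeast0)
    also have "\<dots> = (\<Sum>m\<le>degree (p j). coeff (p j) m * x i ^ m)"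
      using that monic[of j] by (intro sum.mono_neutral_cong_right) (auto simp: coeff_eq_0)
    also have "\<dots> = poly (p j) (x i)" by (simp add: poly_altdef)
    also have "\<dots> = (\<Prod>k<j. x i - x k)" by (simp add: p_def poly_prod)
    finally show ?thesis .
  qed
  have "Determinant.det C = prod_list (diag_mat C)"
    by (rule det_upper_triangular[OF _ C]) (use monic in \<open>auto simp: C_def coeff_eq_0\<close>)
  also have "\<dots> = (\<Prod>i<n. C $$ (i, i))"
    using C by (simp add: prod_list_diag_prod lessThan_atLeast0)
  also have "\<dots> = 1" by (intro prod.neutral) (use monic in \<open>auto simp: C_def, metis\<close>)
  finally have detC: "Determinant.det C = 1" .
  have "Determinant.det (V * C) = prod_list (diag_mat (V * C))"
    by (rule det_lower_triangular[of n]) (use V C entry in \<open>auto intro!: prod_zero\<close>)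
  also have "\<dots> = (\<Prod>i<n. (V * C) $$ (i, i))"
    using V C by (simp add: prod_list_diag_prod lessThan_atLeast0)
  also have "\<dots> = (\<Prod>i<n. \<Prod>k<i. x i - x k)"
    by (rule prod.cong) (auto simp: entry)
  finally show ?thesis using det_mult[OF V C] detC by (simp add: V_def)
qed

text \<open>Amplitudes and nodes are arbitrary here, so the same identity covers both the regular
  signal and a signal padded with zero amplitudes.\<close>

lemma det_hankel_moments:
  fixes a x :: "nat \<Rightarrow> 'a::idom"
  shows "Determinant.det (Matrix.mat n n (\<lambda>(i, j). \<Sum>k<n. a k * x k ^ (i + j)))
    = (\<Prod>k<n. a k) * (\<Prod>i<n. \<Prod>k<i. x i - x k)\<^sup>2"
proof -
  define V where "V = Matrix.mat n n (\<lambda>(i, j). x i ^ j)"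
  have V: "V \<in> carrier_mat n n" by (simp add: V_def)
  have D: "mat_diag n a \<in> carrier_mat n n" by simp
  have eq: "Matrix.mat n n (\<lambda>(i, j). \<Sum>k<n. a k * x k ^ (i + j))
      = transpose_mat V * (mat_diag n a * V)"
    unfolding mat_diag_mult_left[OF V]
    by (rule eq_matI)
      (auto simp: V_def scalar_prod_def lessThan_atLeast0 power_add ac_simps intro!: sum.cong)
  have "Determinant.det (mat_diag n a) = prod_list (diag_mat (mat_diag n a))"
    by (rule det_upper_triangular[OF _ D]) (auto simp: mat_diag_def)
  also have "\<dots> = (\<Prod>k<n. a k)"
    by (simp add: prod_list_diag_prod lessThan_atLeast0 mat_diag_def)
  finally have "Determinant.det (mat_diag n a) = (\<Prod>k<n. a k)" .
  then show ?thesis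
    unfolding eq using V D det_vandermonde[of n x]
    by (simp add: det_mult[OF _ mult_carrier_mat[OF D V]] det_mult[OF D V] det_transpose[OF V]
        power2_eq_square flip: V_def)
qed

text \<open>In the Leibniz formula each of the n! terms is a signed product of n entries. Exchanging
  the factors one at a time changes such a product by at most e * M^(n-1) per factor.\<close>

lemma abs_det_diff_le:
  fixes A B :: "real mat"
  assumes A: "A \<in> carrier_mat n n" and B: "B \<in> carrier_mat n n"
    and n: "n > 0" and M: "M > 0"
    and bA: "\<And>i j. i < n \<Longrightarrow> j < n \<Longrightarrow> \<bar>A $$ (i, j)\<bar> \<le> M"
    and bB: "\<And>i j. i < n \<Longrightarrow> j < n \<Longrightarrow> \<bar>B $$ (i, j)\<bar> \<le> M"
    and diff: "\<And>i j. i < n \<Longrightarrow> j < n \<Longrightarrow> \<bar>A $$ (i, j) - B $$ (i, j)\<bar> \<le> e"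
  shows "\<bar>Determinant.det A - Determinant.det B\<bar> \<le> fact n * (real n * M ^ (n - 1) * e)"
proof -
  have term_le: "\<bar>(\<Prod>i=0..<n. A $$ (i, p i)) - (\<Prod>i=0..<n. B $$ (i, p i))\<bar>
      \<le> real n * M ^ (n - 1) * e" if "p permutes {0..<n}" for p
  proof -
    have p: "p i < n" if "i < n" for i
      using permutes_in_image[OF \<open>p permutes {0..<n}\<close>, of i] that by simp
    \<comment> \<open>\<open>norm_prod_diff\<close> needs factors of norm at most 1, hence the
      division by \<open>M\<close>; the factor M^n is restored afterwards.\<close>
    define u where "u i = A $$ (i, p i) / M" for i
    define v where "v i = B $$ (i, p i) / M" for i
    have "norm ((\<Prod>i=0..<n. u i) - (\<Prod>i=0..<n. v i)) \<le> (\<Sum>i=0..<n. norm (u i - v i))"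
      by (rule norm_prod_diff) (use bA bB p M in \<open>auto simp: u_def v_def\<close>)
    also have "\<dots> \<le> (\<Sum>i=0..<n. e / M)"
    proof (rule sum_mono)
      fix i assume "i \<in> {0..<n}"
      then show "norm (u i - v i) \<le> e / M"
        using diff[of i "p i"] p[of i] M
        by (simp add: u_def v_def divide_right_mono flip: diff_divide_distrib)
    qed
    finally have le: "\<bar>(\<Prod>i=0..<n. u i) - (\<Prod>i=0..<n. v i)\<bar> \<le> real n * (e / M)" by simp
    have "(\<Prod>i=0..<n. A $$ (i, p i)) - (\<Prod>i=0..<n. B $$ (i, p i))
        = M ^ n * ((\<Prod>i=0..<n. u i) - (\<Prod>i=0..<n. v i))"
      using M by (simp add: u_def v_def prod_dividef flip: diff_divide_distrib)
    then have "\<bar>(\<Prod>i=0..<n. A $$ (i, p i)) - (\<Prod>i=0..<n. B $$ (i, p i))\<bar>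
        \<le> M ^ n * (real n * (e / M))"
      using mult_left_mono[OF le, of "M ^ n"] M by (simp add: abs_mult)
    also have "\<dots> = real n * M ^ (n - 1) * e"
      using M n by (cases n) auto
    finally show ?thesis .
  qed
  let ?P = "{p. p permutes {0..<n}}"
  have "\<bar>Determinant.det A - Determinant.det B\<bar>
      = \<bar>\<Sum>p\<in>?P. signof p * ((\<Prod>i=0..<n. A $$ (i, p i)) - (\<Prod>i=0..<n. B $$ (i, p i)))\<bar>"
    by (simp add: det_def'[OF A] det_def'[OF B] right_diff_distrib sum_subtractf)
  also have "\<dots> \<le> (\<Sum>p\<in>?P. real n * M ^ (n - 1) * e)"
    by (rule order_trans[OF sum_abs sum_mono]) (use term_le in \<open>auto simp: abs_mult sign_def\<close>)
  also have "\<dots> = fact n * (real n * M ^ (n - 1) * e)"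
    by (simp add: card_permutations[OF refl])
  finally show ?thesis .
qed

lemma spaced_diff_ge:
  fixes x :: "nat \<Rightarrow> real"
  assumes "\<And>j. Suc j < n \<Longrightarrow> x (Suc j) - x j \<ge> \<eta>" and "k \<le> i" and "i < n"
  shows "x i - x k \<ge> \<eta> * real (i - k)"
  using assms(2,3)
proof (induction i rule: dec_induct)
  case (step i)
  then show ?case using assms(1)[of i] by (simp add: Suc_diff_le algebra_simps)
qed simp

text \<open>Nodes i and k are at least \<eta> * (i - k) apart, so row i of the product contributes
  at least \<eta>^i * i!. Squaring turns the exponent 0 + ... + (n-1) into n(n-1).\<close>

lemma spaced_differences_prod_ge:
  fixes x :: "nat \<Rightarrow> real"
  assumes spaced: "\<And>j. Suc j < n \<Longrightarrow> x (Suc j) - x j \<ge> \<eta>" and \<eta>: "\<eta> > 0"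
  shows "(\<Prod>i<n. \<Prod>k<i. x i - x k)\<^sup>2 \<ge> \<eta> ^ (n * (n - 1)) * (\<Prod>i=1..n - 1. (fact i)\<^sup>2)"
proof -
  have row: "\<eta> ^ i * fact i \<le> (\<Prod>k<i. x i - x k)" if "i < n" for i
  proof -
    have "(\<Prod>k<i. \<eta> * real (i - k)) = \<eta> ^ i * fact i"
      by (simp add: prod.distrib fact_prod_rev lessThan_atLeast0)
    moreover have "(\<Prod>k<i. \<eta> * real (i - k)) \<le> (\<Prod>k<i. x i - x k)"
      using spaced_diff_ge[where x = x, OF spaced] that \<eta> by (intro prod_mono) auto
    ultimately show ?thesis by simp
  qed
  have "(\<Prod>i<n. \<eta> ^ i * fact i)\<^sup>2 \<le> (\<Prod>i<n. \<Prod>k<i. x i - x k)\<^sup>2"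
    by (rule power_mono[OF prod_mono]) (use row \<eta> in \<open>auto intro!: prod_nonneg\<close>)
  moreover have "(\<Prod>i<n. \<eta> ^ i * fact i)\<^sup>2 = \<eta> ^ (n * (n - 1)) * (\<Prod>i=1..n - 1. (fact i)\<^sup>2)"
  proof (induction n)
    case (Suc n)
    have "(\<Prod>i=1..n. (fact i)\<^sup>2) = (\<Prod>i=1..n - 1. (fact i :: real)\<^sup>2) * (fact n)\<^sup>2"
      by (cases n) auto
    moreover have "Suc n * n = n * (n - 1) + 2 * n" by (cases n) auto
    ultimately show ?case
      using Suc.IH by (simp add: power_add power_mult mult_ac power2_eq_square)
  qed simp
  ultimately show ?thesis by simp
qed

lemma moment_downscale: "moment k (downscale h (a, x)) = h ^ k * moment k (a, x)"
  if "length x = length a"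
  using that by (simp add: moment_def downscale_def power_mult_distrib sum_distrib_left mult_ac)

lemma abs_moment_diff_le_moment_dist:
  "\<bar>moment k F - moment k G\<bar> \<le> moment_dist d F G" if "k \<le> 2 * d - 2"
  using member_le_L2_set[of "{0..2 * d - 2}" k "\<lambda>k. \<bar>moment k F - moment k G\<bar>"] that
  by (simp add: moment_dist_def L2_set_def)

lemma abs_moment_le: "\<bar>moment k G\<bar> \<le> real d" if "G \<in> bounded_signals d"
proof -
  obtain a x where G: "G = (a, x)" by force
  have "\<bar>\<Sum>j<d. a ! j * (x ! j) ^ k\<bar> \<le> (\<Sum>j<d. 1)"
  proof (rule order_trans[OF sum_abs sum_mono])
    fix j assume "j \<in> {..<d}"
    then show "\<bar>a ! j * (x ! j) ^ k\<bar> \<le> 1"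
      using that G by (auto simp: bounded_signals_def abs_mult power_abs intro!: mult_le_one power_le_one)
  qed
  then show ?thesis using that G by (auto simp: moment_def bounded_signals_def signals_def)
qed

text \<open>Dividing the k-th moment by h^k amounts to dividing the nodes by h. For j beyond the
  list the value of \<open>x ! j\<close> is unspecified, but its amplitude is 0.\<close>

lemma moment_padded:
  assumes "length a \<le> n"
  shows "moment k (a, x) / h ^ k = (\<Sum>j<n. (if j < length a then a ! j else 0) * (x ! j / h) ^ k)"
proof -
  have "(\<Sum>j<n. (if j < length a then a ! j else 0) * (x ! j / h) ^ k)
      = (\<Sum>j<length a. a ! j * (x ! j / h) ^ k)"
    using assms by (intro sum.mono_neutral_cong_right) auto
  then show ?thesis by (simp add: moment_def power_divide sum_divide_distrib)
qed

lemma hankel_det_regular_ge: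
  assumes G: "regular_signal d \<eta> \<gamma> G" and "0 < \<eta>" and "0 < \<gamma>"
  shows "\<bar>Determinant.det (Matrix.mat d d (\<lambda>(i, j). moment (i + j) G))\<bar>
    \<ge> \<eta> ^ (d * (d - 1)) * \<gamma> ^ d * (\<Prod>i=1..d - 1. (fact i)\<^sup>2)"
proof -
  obtain a x where ax: "G = (a, x)" by force
  have len: "length a = d"
    and spaced: "\<And>j. Suc j < d \<Longrightarrow> x ! Suc j - x ! j \<ge> \<eta>"
    and amp: "\<And>j. j < d \<Longrightarrow> \<bar>a ! j\<bar> \<ge> \<gamma>"
    using G by (auto simp: ax regular_signal_def bounded_signals_def signals_def)
  have "\<gamma> ^ d \<le> (\<Prod>k<d. \<bar>a ! k\<bar>)"
    using prod_mono[of "{..<d}" "\<lambda>_. \<gamma>" "\<lambda>k. \<bar>a ! k\<bar>"] amp \<open>0 < \<gamma>\<close> by auto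
  moreover have "\<eta> ^ (d * (d - 1)) * (\<Prod>i=1..d - 1. (fact i)\<^sup>2)
      \<le> (\<Prod>i<d. \<Prod>k<i. x ! i - x ! k)\<^sup>2"
    by (rule spaced_differences_prod_ge) (use spaced \<open>0 < \<eta>\<close> in auto)
  ultimately have "\<gamma> ^ d * (\<eta> ^ (d * (d - 1)) * (\<Prod>i=1..d - 1. (fact i)\<^sup>2))
      \<le> (\<Prod>k<d. \<bar>a ! k\<bar>) * (\<Prod>i<d. \<Prod>k<i. x ! i - x ! k)\<^sup>2"
    by (rule mult_mono) (use \<open>0 < \<eta>\<close> in \<open>auto intro!: prod_nonneg mult_nonneg_nonneg\<close>)
  then show ?thesis
    using det_hankel_moments[of d "(!) a" "(!) x"]
    by (simp add: ax moment_def len abs_mult abs_prod mult_ac)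
qed

lemma hankel_det_few_nodes:
  assumes F: "F \<in> signals l" and "l < d"
  shows "Determinant.det (Matrix.mat d d (\<lambda>(i, j). moment (i + j) F / h ^ (i + j))) = 0"
proof -
  obtain b y where F': "F = (b, y)" by force
  have len: "length b = l" using F by (simp add: F' signals_def)
  \<comment> \<open>The padded amplitude at index \<open>l\<close> is a zero factor.\<close>
  have "(\<Prod>k<d. if k < l then b ! k else 0) = 0"
    using \<open>l < d\<close> by (intro prod_zero) auto
  then show ?thesis
    using det_hankel_moments[of d "\<lambda>k. if k < l then b ! k else 0" "\<lambda>k. y ! k / h"] \<open>l < d\<close>
    by (simp add: F' moment_padded[of b d] len)
qed

theorem corollary3p2:
  fixes d l :: nat and h \<eta> \<gamma> :: real and F F' :: signal
  assumes "d \<ge> 2"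
    and "0 < h" and "h < 1"
    and "0 < \<eta>" and "\<eta> \<le> 2 / (real d - 1)"
    and "0 < \<gamma>" and "\<gamma> \<le> 1"
    and "F \<in> bounded_signals d"
    and "regular_cluster d h \<eta> \<gamma> F"
    and "l < d"
    and "F' \<in> signals l"
  shows "moment_dist d F F' \<ge>
           min (h ^ (2 * d - 2))
               (\<eta> ^ (d * (d - 1)) * \<gamma> ^ d * h ^ (2 * d - 2) * (\<Prod>i=1..d - 1. (fact i)\<^sup>2)
                / (sqrt (2 * real d - 1) * (real d)\<^sup>2 * fact d * (real d + 1) ^ (d - 1)))"
\<comment> \<open>If the distance reaches the first entry of the minimum, nothing is left to show.
  Otherwise the rescaled error \<delta> / H is at most 1, which keeps the entries of
  \<open>B\<close> below bounded.\<close>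
proof (cases "moment_dist d F F' \<ge> h ^ (2 * d - 2)")
  case False
  define \<delta> where "\<delta> = moment_dist d F F'"
  define H where "H = h ^ (2 * d - 2)"
  define L where "L = \<eta> ^ (d * (d - 1)) * \<gamma> ^ d * (\<Prod>i=1..d - 1. (fact i)\<^sup>2)"
  define Q where "Q = real d * fact d * (real d + 1) ^ (d - 1)"
  have H: "H > 0" and Q: "Q > 0" and \<delta>: "\<delta> \<ge> 0"
    using assms(1,2) by (auto simp: H_def Q_def \<delta>_def moment_dist_def L2_set_nonneg)
  have small: "\<delta> / H \<le> 1" using False H by (simp add: \<delta>_def H_def)
  obtain G where G: "regular_signal d \<eta> \<gamma> G" and F: "F = downscale h G"
    using assms(9) by (auto simp: regular_cluster_def)
  have Gb: "G \<in> bounded_signals d" using G by (simp add: regular_signal_def)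
  have mF: "moment k F = h ^ k * moment k G" for k
    using Gb by (cases G) (auto simp: F moment_downscale bounded_signals_def signals_def)
  define A where "A = Matrix.mat d d (\<lambda>(i, j). moment (i + j) G)"
  define B where "B = Matrix.mat d d (\<lambda>(i, j). moment (i + j) F' / h ^ (i + j))"
  have close: "\<bar>A $$ (i, j) - B $$ (i, j)\<bar> \<le> \<delta> / H" if "i < d" "j < d" for i j
  proof -
    have "A $$ (i, j) - B $$ (i, j) = (moment (i + j) F - moment (i + j) F') / h ^ (i + j)"
      using that assms(2) by (simp add: A_def B_def mF field_simps)
    then have "\<bar>A $$ (i, j) - B $$ (i, j)\<bar>
        = \<bar>moment (i + j) F - moment (i + j) F'\<bar> / h ^ (i + j)"
      using assms(2) by simp
    also have "\<dots> \<le> \<delta> / h ^ (i + j)"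
      using that assms(2) unfolding \<delta>_def
      by (intro divide_right_mono abs_moment_diff_le_moment_dist) auto
    \<comment> \<open>As i + j is at most 2d - 2 and h < 1, the worst amplification is 1 /
      H.\<close>
    also have "\<dots> \<le> \<delta> / H"
      unfolding H_def using that assms(2,3) \<delta>
      by (intro divide_left_mono power_decreasing) auto
    finally show ?thesis .
  qed
  have bA: "\<bar>A $$ (i, j)\<bar> \<le> real d" if "i < d" "j < d" for i j
    using abs_moment_le[OF Gb] that by (simp add: A_def)
  have "\<bar>Determinant.det A - Determinant.det B\<bar>
      \<le> fact d * (real d * (real d + 1) ^ (d - 1) * (\<delta> / H))"
  proof (rule abs_det_diff_le)
    fix i j assume ij: "i < d" "j < d"
    show "\<bar>A $$ (i, j)\<bar> \<le> real d + 1" using bA[OF ij] by simp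
    \<comment> \<open>An entry of \<open>A\<close> is at most d in absolute value and the error at
      most 1; this is where d + 1 in the final constant comes from.\<close>
    show "\<bar>B $$ (i, j)\<bar> \<le> real d + 1" using bA[OF ij] close[OF ij] small by linarith
    show "\<bar>A $$ (i, j) - B $$ (i, j)\<bar> \<le> \<delta> / H" by (rule close[OF ij])
  qed (use assms(1) in \<open>auto simp: A_def B_def\<close>)
  moreover have "Determinant.det B = 0"
    unfolding B_def using assms(10,11) by (intro hankel_det_few_nodes)
  moreover have "L \<le> \<bar>Determinant.det A\<bar>"
    unfolding L_def A_def by (rule hankel_det_regular_ge[OF G assms(4,6)])
  ultimately have "L \<le> Q * (\<delta> / H)" by (simp add: Q_def mult_ac)
  then have main: "L * H / Q \<le> \<delta>" using H Q by (simp add: field_simps)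
  have L: "L \<ge> 0" using assms(4,6) by (auto simp: L_def intro!: prod_nonneg mult_nonneg_nonneg)
  \<comment> \<open>The denominator in the claim is \<open>Q\<close> times sqrt(2d-1) * d. This
    extra factor is at least 1, so the claim is a weakening of \<open>main\<close>.\<close>
  have "1 \<le> sqrt (2 * real d - 1) * real d"
    using mult_mono[of 1 "sqrt (2 * real d - 1)" 1 "real d"] assms(1) by simp
  then have "Q \<le> (sqrt (2 * real d - 1) * real d) * Q" using Q by simp
  then have "L * H / ((sqrt (2 * real d - 1) * real d) * Q) \<le> L * H / Q"
    using L H Q by (intro divide_left_mono) auto
  also note main
  finally show ?thesis
    by (simp add: \<delta>_def L_def H_def Q_def power2_eq_square mult_ac min.coboundedI2)
qed auto

end
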